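(* Let $A$ be the free $\mathbb{Z}$-module with basis $e_1,\dots,e_n,f_1,\dots,f_n,g_1,\dots,g_n$. For $i=1,\dots,n-1$ define automorphisms $\Delta(\sigma_i):e_i\mapsto e_{i+1}+g_i,\ e_{i+1}\mapsto e_i-g_{i+1},\ g_i\mapsto g_{i+1},\ g_{i+1}\mapsto g_i$ and $\Delta(\rho_i):e_i\leftrightarrow e_{i+1},\ f_i\leftrightarrow f_{i+1},\ g_i\leftrightarrow g_{i+1}$ (swaps), all other basis elements fixed. Then this extends to a linear representation $\Delta:FVB_n\to{\rm Aut}(A)={\rm GL}_{3n}(\mathbb{Z})$. Moreover, $\Delta$ does not preserve the forbidden relations (for $n\ge3$ and $i=1,\dots,n-2$, $\Delta(\rho_i\sigma_{i+1}\sigma_i)\ne\Delta(\sigma_{i+1}\sigma_i\rho_{i+1})$), and for $i=1,\dots,n-2$ the elements $(\rho_i\sigma_{i+1})^6$ do not belong to $\ker(\Delta)$.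
   Context: $FVB_n$ is the flat virtual braid group: generators $\sigma_1,\dots,\sigma_{n-1},\rho_1,\dots,\rho_{n-1}$, relations $\sigma_i\sigma_j=\sigma_j\sigma_i$, $\rho_i\rho_j=\rho_j\rho_i$, $\sigma_i\rho_j=\rho_j\sigma_i$ for $|i-j|\ge2$; $\sigma_i\sigma_{i+1}\sigma_i=\sigma_{i+1}\sigma_i\sigma_{i+1}$; $\rho_i\rho_{i+1}\rho_i=\rho_{i+1}\rho_i\rho_{i+1}$; $\rho_i\rho_{i+1}\sigma_i=\sigma_{i+1}\rho_i\rho_{i+1}$; $\rho_i^2=\sigma_i^2=1$. The forbidden relations are $\rho_i\sigma_{i+1}\sigma_i=\sigma_{i+1}\sigma_i\rho_{i+1}$. Maps are composed on the right: $(fg)(x)=g(f(x))$. *)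

theory Defs
  imports "Jordan_Normal_Form.Matrix"
begin

text \<open>Generators of the flat virtual braid group FVB_n: Sig i = sigma_i, Rho i = rho_i
  (1 \<le> i \<le> n-1). Elements of FVB_n are represented by words over the generators;
  since every generator is an involution, words (without formal inverses) represent all
  group elements.\<close>

datatype gen = Sig nat | Rho nat

definition gen_idx :: "gen \<Rightarrow> nat" where
  "gen_idx g = (case g of Sig i \<Rightarrow> i | Rho i \<Rightarrow> i)"

definition valid_word :: "nat \<Rightarrow> gen list \<Rightarrow> bool" where
  "valid_word n w \<longleftrightarrow> (\<forall>g \<in> set w. 1 \<le> gen_idx g \<and> gen_idx g \<le> n - 1)"

inductive fvb_basic :: "nat \<Rightarrow> gen list \<Rightarrow> gen list \<Rightarrow> bool" for n where
  comm_ss: "\<lbrakk>1 \<le> i; i \<le> n - 1; 1 \<le> j; j \<le> n - 1; i + 2 \<le> j \<or> j + 2 \<le> i\<rbrakk>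
      \<Longrightarrow> fvb_basic n [Sig i, Sig j] [Sig j, Sig i]"
| comm_rr: "\<lbrakk>1 \<le> i; i \<le> n - 1; 1 \<le> j; j \<le> n - 1; i + 2 \<le> j \<or> j + 2 \<le> i\<rbrakk>
      \<Longrightarrow> fvb_basic n [Rho i, Rho j] [Rho j, Rho i]"
| comm_sr: "\<lbrakk>1 \<le> i; i \<le> n - 1; 1 \<le> j; j \<le> n - 1; i + 2 \<le> j \<or> j + 2 \<le> i\<rbrakk>
      \<Longrightarrow> fvb_basic n [Sig i, Rho j] [Rho j, Sig i]"
| braid_s: "\<lbrakk>1 \<le> i; i + 1 \<le> n - 1\<rbrakk>
      \<Longrightarrow> fvb_basic n [Sig i, Sig (i+1), Sig i] [Sig (i+1), Sig i, Sig (i+1)]"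
| braid_r: "\<lbrakk>1 \<le> i; i + 1 \<le> n - 1\<rbrakk>
      \<Longrightarrow> fvb_basic n [Rho i, Rho (i+1), Rho i] [Rho (i+1), Rho i, Rho (i+1)]"
| mixed: "\<lbrakk>1 \<le> i; i + 1 \<le> n - 1\<rbrakk>
      \<Longrightarrow> fvb_basic n [Rho i, Rho (i+1), Sig i] [Sig (i+1), Rho i, Rho (i+1)]"
| inv_r: "\<lbrakk>1 \<le> i; i \<le> n - 1\<rbrakk> \<Longrightarrow> fvb_basic n [Rho i, Rho i] []"
| inv_s: "\<lbrakk>1 \<le> i; i \<le> n - 1\<rbrakk> \<Longrightarrow> fvb_basic n [Sig i, Sig i] []"

text \<open>The congruence on valid words generated by the defining relations;
  FVB_n is the quotient of valid words by this congruence.\<close>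

inductive fvb_eq :: "nat \<Rightarrow> gen list \<Rightarrow> gen list \<Rightarrow> bool" for n where
  basic: "\<lbrakk>fvb_basic n u v; valid_word n x; valid_word n y\<rbrakk>
      \<Longrightarrow> fvb_eq n (x @ u @ y) (x @ v @ y)"
| refl: "valid_word n w \<Longrightarrow> fvb_eq n w w"
| sym: "fvb_eq n u v \<Longrightarrow> fvb_eq n v u"
| trans: "\<lbrakk>fvb_eq n u v; fvb_eq n v w\<rbrakk> \<Longrightarrow> fvb_eq n u w"

text \<open>The module A = Z^(3n) with basis e_1..e_n, f_1..f_n, g_1..g_n, indexed
  0-based as e_i \<mapsto> i-1, f_i \<mapsto> n+i-1, g_i \<mapsto> 2n+i-1.
  An endomorphism is represented by its 3n x 3n integer matrix whose row r is the
  coordinate vector of the image of the r-th basis element. With this row convention,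
  maps composed on the right ((fg)(x) = g(f(x))) correspond to the matrix product
  M_f * M_g.\<close>

definition eI :: "nat \<Rightarrow> nat \<Rightarrow> nat" where "eI n i = i - 1"
definition fI :: "nat \<Rightarrow> nat \<Rightarrow> nat" where "fI n i = n + i - 1"
definition gI :: "nat \<Rightarrow> nat \<Rightarrow> nat" where "gI n i = 2 * n + i - 1"

definition sigma_mat :: "nat \<Rightarrow> nat \<Rightarrow> int mat" where
  "sigma_mat n i = mat (3 * n) (3 * n) (\<lambda>(r, c).
     if r = eI n i then (if c = eI n (i+1) \<or> c = gI n i then 1 else 0)
     else if r = eI n (i+1) then (if c = eI n i then 1 else if c = gI n (i+1) then -1 else 0)
     else if r = gI n i then (if c = gI n (i+1) then 1 else 0)
     else if r = gI n (i+1) then (if c = gI n i then 1 else 0)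
     else (if r = c then 1 else 0))"

definition rho_perm :: "nat \<Rightarrow> nat \<Rightarrow> nat \<Rightarrow> nat" where
  "rho_perm n i r =
     (if r = eI n i then eI n (i+1) else if r = eI n (i+1) then eI n i
      else if r = fI n i then fI n (i+1) else if r = fI n (i+1) then fI n i
      else if r = gI n i then gI n (i+1) else if r = gI n (i+1) then gI n i
      else r)"

definition rho_mat :: "nat \<Rightarrow> nat \<Rightarrow> int mat" where
  "rho_mat n i = mat (3 * n) (3 * n) (\<lambda>(r, c). if c = rho_perm n i r then 1 else 0)"

definition Delta_gen :: "nat \<Rightarrow> gen \<Rightarrow> int mat" where
  "Delta_gen n g = (case g of Sig i \<Rightarrow> sigma_mat n i | Rho i \<Rightarrow> rho_mat n i)"

definition Delta_word :: "nat \<Rightarrow> gen list \<Rightarrow> int mat" where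
  "Delta_word n w = foldr (\<lambda>g M. Delta_gen n g * M) w (1\<^sub>m (3 * n))"

end

theory Submission
  imports Defs
begin

text \<open>The matrix of a word is determined by its action on column vectors, that is, on linear
  functionals \<open>\<phi>\<close> on \<open>A\<close>, where \<open>w\<close> sends \<open>\<phi>\<close> to \<open>\<phi> \<circ> \<Delta>(w)\<close>. Writing a functional as a function
  on the named basis elements makes every relation a pointwise identity.
  The forbidden relation fails because \<open>\<sigma>\<close> fixes all \<open>f\<^sub>j\<close>, so that its two sides permute the \<open>f\<^sub>j\<close>
  by different transpositions. For the last claim, the cube of \<open>\<rho>\<^sub>i \<sigma>\<^bsub>i+1\<^esub>\<close> maps
  \<open>e\<^sub>i\<close> to \<open>e\<^sub>i - g\<^bsub>i+1\<^esub> + g\<^bsub>i+2\<^esub>\<close> and fixes the \<open>g\<^sub>j\<close>, so its square is not the identity.\<close>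

section \<open>Action of words on functionals\<close>

datatype basis = E nat | F nat | G nat

text \<open>Indices carry no bound, so one action serves every \<open>n\<close>. All updates read
  the original \<open>\<phi>\<close>, which makes them simultaneous.\<close>

fun act :: "gen \<Rightarrow> (basis \<Rightarrow> int) \<Rightarrow> basis \<Rightarrow> int" where
  "act (Sig i) \<phi> = \<phi>(E i := \<phi> (E (Suc i)) + \<phi> (G i), E (Suc i) := \<phi> (E i) - \<phi> (G (Suc i)),
     G i := \<phi> (G (Suc i)), G (Suc i) := \<phi> (G i))"
| "act (Rho i) \<phi> = \<phi>(E i := \<phi> (E (Suc i)), E (Suc i) := \<phi> (E i),
     F i := \<phi> (F (Suc i)), F (Suc i) := \<phi> (F i),
     G i := \<phi> (G (Suc i)), G (Suc i) := \<phi> (G i))"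

text \<open>Generators with indices at distance at least two change values at disjoint sets of named
  elements, hence commute. The other relations compare values at finitely many names.\<close>

lemma act_basic_relation:
  assumes "fvb_basic n u v"
  shows "foldr act u \<phi> = foldr act v \<phi>"
  using assms by cases (auto simp: fun_eq_iff)

lemma act_fvb_eq:
  assumes "fvb_eq n u v"
  shows "foldr act u = foldr act v"
  using assms by induction (auto simp: fun_eq_iff act_basic_relation)

lemma valid_word_basic:
  assumes "fvb_basic n u v"
  shows "valid_word n u \<and> valid_word n v"
  using assms by cases (auto simp: valid_word_def gen_idx_def)

lemma valid_word_append: "valid_word n (u @ v) \<longleftrightarrow> valid_word n u \<and> valid_word n v"
  by (auto simp: valid_word_def)

lemma valid_word_Cons: "valid_word n (g # w) \<longleftrightarrow> valid_word n [g] \<and> valid_word n w"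
  by (auto simp: valid_word_def)

lemma fvb_eq_valid:
  assumes "fvb_eq n u v"
  shows "valid_word n u \<and> valid_word n v"
  using assms by induction (auto simp: valid_word_append dest: valid_word_basic)

section \<open>Named basis elements and coordinates\<close>

text \<open>Inverse of the numberings \<open>eI\<close>, \<open>fI\<close>, \<open>gI\<close>: rows
  count from 0, names from 1.\<close>

definition basis_of :: "nat \<Rightarrow> nat \<Rightarrow> basis" where
  "basis_of n r = (if r < n then E (Suc r) else if r < 2 * n then F (Suc r - n)
     else G (Suc r - 2 * n))"

definition coords :: "nat \<Rightarrow> (basis \<Rightarrow> int) \<Rightarrow> int vec" where
  "coords n \<phi> = vec (3 * n) (\<phi> \<circ> basis_of n)"

lemma coords_carrier [simp]: "coords n \<phi> \<in> carrier_vec (3 * n)"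
  by (simp add: coords_def)

lemma basis_of_eI: "\<lbrakk>1 \<le> i; i \<le> n\<rbrakk> \<Longrightarrow> basis_of n (eI n i) = E i"
  and basis_of_fI: "\<lbrakk>1 \<le> i; i \<le> n\<rbrakk> \<Longrightarrow> basis_of n (fI n i) = F i"
  and basis_of_gI: "\<lbrakk>1 \<le> i; i \<le> n\<rbrakk> \<Longrightarrow> basis_of n (gI n i) = G i"
  by (auto simp: basis_of_def eI_def fI_def gI_def)

lemma index_less:
  assumes "1 \<le> i" "i \<le> n"
  shows "eI n i < 3 * n" "fI n i < 3 * n" "gI n i < 3 * n"
  using assms by (auto simp: eI_def fI_def gI_def)

lemma basis_of_inj: "\<lbrakk>basis_of n r = basis_of n s; r < 3 * n; s < 3 * n\<rbrakk> \<Longrightarrow> r = s"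
  by (auto simp: basis_of_def split: if_splits)

text \<open>Turns the row tests in the matrix definitions into comparisons of constructors, as they
  occur in \<open>act\<close>.\<close>

lemma basis_of_eq_iff:
  assumes "1 \<le> i" "i \<le> n" "r < 3 * n"
  shows "r = eI n i \<longleftrightarrow> basis_of n r = E i"
    and "r = fI n i \<longleftrightarrow> basis_of n r = F i"
    and "r = gI n i \<longleftrightarrow> basis_of n r = G i"
  using assms by (metis basis_of_eI basis_of_inj index_less(1),
    metis basis_of_fI basis_of_inj index_less(2), metis basis_of_gI basis_of_inj index_less(3))

lemma coords_surj:
  assumes "x \<in> carrier_vec (3 * n)"
  obtains \<phi> where "coords n \<phi> = x"
proof
  \<comment> \<open>The description inverts \<open>basis_of n\<close> on rows below
    \<open>3 * n\<close>; at other names the value of the functional is irrelevant.\<close>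
  show "coords n (\<lambda>b. x $ (THE r. r < 3 * n \<and> basis_of n r = b)) = x"
  proof (rule eq_vecI)
    fix r assume "r < dim_vec x"
    then have r: "r < 3 * n" using assms by auto
    then have "(THE s. s < 3 * n \<and> basis_of n s = basis_of n r) = r"
      by (blast intro: the_equality basis_of_inj)
    then show "coords n (\<lambda>b. x $ (THE r. r < 3 * n \<and> basis_of n r = b)) $ r = x $ r"
      using r by (simp add: coords_def)
  qed (use assms in \<open>auto simp: coords_def\<close>)
qed

lemma Delta_gen_carrier [simp]: "Delta_gen n g \<in> carrier_mat (3 * n) (3 * n)"
  by (auto simp: Delta_gen_def sigma_mat_def rho_mat_def split: gen.split)

lemma Delta_word_Nil: "Delta_word n [] = 1\<^sub>m (3 * n)"
  and Delta_word_Cons: "Delta_word n (g # w) = Delta_gen n g * Delta_word n w"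
  by (simp_all add: Delta_word_def)

lemma Delta_word_carrier [simp]: "Delta_word n w \<in> carrier_mat (3 * n) (3 * n)"
  by (induction w) (auto simp: Delta_word_Nil Delta_word_Cons intro!: mult_carrier_mat)

section \<open>Matrices as the action in coordinates\<close>

lemma sum_if_mult:
  fixes y :: "nat \<Rightarrow> int"
  assumes "a < m"
  shows "(\<Sum>c = 0..<m. (if c = a then k else 0) * y c) = k * y a"
  using assms by (simp add: if_distrib[of "\<lambda>t. t * _"] cong: if_cong)

text \<open>Serves the rows of \<open>e_i\<close> and \<open>e_(i+1)\<close> in
  \<open>sigma_mat\<close>, the only ones with two nonzero entries.\<close>

lemma sum_if2_mult:
  fixes y :: "nat \<Rightarrow> int"
  assumes "a < m" "b < m" "a \<noteq> b"
  shows "(\<Sum>c = 0..<m. (if c = a then k else if c = b then l else 0) * y c) = k * y a + l * y b"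
proof -
  have "(\<Sum>c = 0..<m. (if c = a then k else if c = b then l else 0) * y c) =
    (\<Sum>c = 0..<m. (if c = a then k else 0) * y c + (if c = b then l else 0) * y c)"
    using assms(3) by (intro sum.cong) auto
  then show ?thesis
    using assms by (simp only: sum.distrib sum_if_mult)
qed

lemma rho_perm_less:
  assumes "1 \<le> i" "i < n" "r < 3 * n"
  shows "rho_perm n i r < 3 * n"
  using assms by (auto simp: rho_perm_def index_less)

lemma mat_mult_coords_nth:
  assumes "r < 3 * n"
  shows "(mat (3 * n) (3 * n) f *\<^sub>v coords n \<phi>) $ r =
    (\<Sum>c = 0..<3 * n. f (r, c) * \<phi> (basis_of n c))"
  using assms by (auto simp: coords_def scalar_prod_def intro!: sum.cong)

lemma rho_mat_mult_coords:
  assumes "1 \<le> i" "i < n"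
  shows "rho_mat n i *\<^sub>v coords n \<phi> = coords n (act (Rho i) \<phi>)"
proof (rule eq_vecI)
  fix r assume "r < dim_vec (coords n (act (Rho i) \<phi>))"
  then have r: "r < 3 * n" by (simp add: coords_def)
  have "(rho_mat n i *\<^sub>v coords n \<phi>) $ r =
    (\<Sum>c = 0..<3 * n. (if c = rho_perm n i r then 1 else 0) * \<phi> (basis_of n c))"
    \<comment> \<open>Without \<open>index_mult_mat_vec\<close> the entry stays folded until
      \<open>mat_mult_coords_nth\<close> expands it as a sum over columns.\<close>
    using r by (simp add: rho_mat_def mat_mult_coords_nth del: index_mult_mat_vec)
  also have "\<dots> = \<phi> (basis_of n (rho_perm n i r))"
    using rho_perm_less[OF assms r] by (simp add: sum_if_mult)
  also have "\<dots> = act (Rho i) \<phi> (basis_of n r)"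
    using assms r by (simp add: rho_perm_def basis_of_eq_iff basis_of_eI basis_of_fI basis_of_gI)
  finally show "(rho_mat n i *\<^sub>v coords n \<phi>) $ r = coords n (act (Rho i) \<phi>) $ r"
    using r by (simp add: coords_def)
qed (simp add: rho_mat_def coords_def)

lemma sigma_mat_mult_coords:
  assumes "1 \<le> i" "i < n"
  shows "sigma_mat n i *\<^sub>v coords n \<phi> = coords n (act (Sig i) \<phi>)"
proof (rule eq_vecI)
  fix r assume "r < dim_vec (coords n (act (Sig i) \<phi>))"
  then have r: "r < 3 * n" by (simp add: coords_def)
  have ne: "eI n (Suc i) \<noteq> eI n i" "eI n j \<noteq> gI n k" "gI n k \<noteq> eI n j" "gI n (Suc i) \<noteq> gI n i"
    if "j \<le> n" "1 \<le> k" for j k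
    using assms that by (auto simp: eI_def gI_def)
  note ne = ne[of i i] ne[of "Suc i" i] ne[of i "Suc i"] ne[of "Suc i" "Suc i"]
  \<comment> \<open>Brings the row of \<open>e_i\<close>, whose two unit entries are given by a
    disjunction, into the nested form of \<open>sum_if2_mult\<close>.\<close>
  have if_or: "(if P \<or> Q then 1 else 0) = (if P then 1 else if Q then 1 else (0::int))" for P Q
    by simp
  consider "r = eI n i" | "r = eI n (Suc i)" | "r = gI n i" | "r = gI n (Suc i)"
    | "r \<notin> {eI n i, eI n (Suc i), gI n i, gI n (Suc i)}"
    by blast
  then have "(sigma_mat n i *\<^sub>v coords n \<phi>) $ r = act (Sig i) \<phi> (basis_of n r)"
  proof cases
    case 1
    with r assms ne show ?thesis
      by (simp add: sigma_mat_def mat_mult_coords_nth if_or sum_if2_mult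
          index_less basis_of_eI basis_of_gI del: index_mult_mat_vec)
  next
    case 2
    with r assms ne show ?thesis
      by (simp add: sigma_mat_def mat_mult_coords_nth sum_if2_mult
          index_less basis_of_eI basis_of_gI del: index_mult_mat_vec)
  next
    case 3
    with r assms ne show ?thesis
      by (simp add: sigma_mat_def mat_mult_coords_nth sum_if_mult
          index_less basis_of_gI del: index_mult_mat_vec)
  next
    case 4
    with r assms ne show ?thesis
      by (simp add: sigma_mat_def mat_mult_coords_nth sum_if_mult
          index_less basis_of_gI del: index_mult_mat_vec)
  next
    case 5
    have flip: "(if r = c then 1 else 0) = (if c = r then 1 else (0::int))" for c
      by auto
    have "basis_of n r \<notin> {E i, E (Suc i), G i, G (Suc i)}"
      using 5 r assms by (simp add: basis_of_eq_iff)
    with 5 r show ?thesis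
      by (simp add: sigma_mat_def mat_mult_coords_nth flip sum_if_mult del: index_mult_mat_vec)
  qed
  then show "(sigma_mat n i *\<^sub>v coords n \<phi>) $ r = coords n (act (Sig i) \<phi>) $ r"
    using r by (simp add: coords_def)
qed (simp add: sigma_mat_def coords_def)

lemma Delta_gen_mult_coords:
  assumes "valid_word n [g]"
  shows "Delta_gen n g *\<^sub>v coords n \<phi> = coords n (act g \<phi>)"
  using assms
  by (cases g) (auto simp: valid_word_def gen_idx_def Delta_gen_def
      sigma_mat_mult_coords rho_mat_mult_coords simp del: act.simps)

lemma Delta_word_mult_coords:
  assumes "valid_word n w"
  shows "Delta_word n w *\<^sub>v coords n \<phi> = coords n (foldr act w \<phi>)"
  using assms
proof (induction w)
  case Nil
  then show ?case by (simp add: Delta_word_Nil)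
next
  case (Cons g w)
  have "Delta_word n (g # w) *\<^sub>v coords n \<phi> = Delta_gen n g *\<^sub>v (Delta_word n w *\<^sub>v coords n \<phi>)"
    unfolding Delta_word_Cons
    by (rule assoc_mult_mat_vec[OF Delta_gen_carrier Delta_word_carrier coords_carrier])
  also have "\<dots> = coords n (foldr act (g # w) \<phi>)"
    using Cons valid_word_Cons[of n g w] by (simp add: Delta_gen_mult_coords del: act.simps)
  finally show ?case .
qed

text \<open>The products with unit vectors are the columns.\<close>

lemma mat_eqI_mult_vec:
  fixes M N :: "'a :: semiring_1 mat"
  assumes "M \<in> carrier_mat m k" "N \<in> carrier_mat m k"
    and "\<And>x. x \<in> carrier_vec k \<Longrightarrow> M *\<^sub>v x = N *\<^sub>v x"
  shows "M = N"
proof (rule eq_matI)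
  fix i j assume "i < dim_row N" "j < dim_col N"
  with assms(1,2) assms(3)[OF unit_vec_carrier[of k j]]
  show "M $$ (i, j) = N $$ (i, j)"
    by (auto dest!: arg_cong[of _ _ "\<lambda>v. v $ i"])
qed (use assms in auto)

section \<open>The representation and its non-relations\<close>

lemma Delta_word_fvb_eq:
  assumes "fvb_eq n u v"
  shows "Delta_word n u = Delta_word n v"
proof (rule mat_eqI_mult_vec[OF Delta_word_carrier Delta_word_carrier])
  fix x :: "int vec" assume "x \<in> carrier_vec (3 * n)"
  then obtain \<phi> where "coords n \<phi> = x" by (rule coords_surj)
  then show "Delta_word n u *\<^sub>v x = Delta_word n v *\<^sub>v x"
    using fvb_eq_valid[OF assms] Delta_word_mult_coords act_fvb_eq[OF assms] by metis
qed

text \<open>Used to refute an equality of matrices by a single functional and a single basis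
  element.\<close>

lemma act_eq_if_Delta_word_eq:
  assumes "Delta_word n u = Delta_word n v" "valid_word n u" "valid_word n v"
    and "r < 3 * n"
  shows "foldr act u \<phi> (basis_of n r) = foldr act v \<phi> (basis_of n r)"
proof -
  have "coords n (foldr act u \<phi>) = coords n (foldr act v \<phi>)"
    using assms Delta_word_mult_coords by metis
  then show ?thesis
    using assms(4) by (auto simp: coords_def dest!: arg_cong[of _ _ "\<lambda>x. x $ r"])
qed

text \<open>An instance of the relations \<open>inv_s\<close> and \<open>inv_r\<close>, so each
  generator's matrix is its own inverse.\<close>

lemma Delta_gen_involution:
  assumes "valid_word n [g]"
  shows "Delta_gen n g * Delta_gen n g = 1\<^sub>m (3 * n)"
proof -
  have "fvb_basic n [g, g] []"
    using assms by (cases g) (auto simp: valid_word_def gen_idx_def intro: inv_s inv_r)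
  then have "fvb_eq n [g, g] []"
    using fvb_eq.basic[of n "[g, g]" "[]" "[]" "[]"] by (simp add: valid_word_def)
  then have "Delta_word n [g, g] = Delta_word n []"
    by (rule Delta_word_fvb_eq)
  then show ?thesis
    by (simp add: Delta_word_Cons Delta_word_Nil right_mult_one_mat[OF Delta_gen_carrier])
qed

lemma Delta_gen_invertible:
  assumes "valid_word n [g]"
  shows "invertible_mat (Delta_gen n g)"
  using Delta_gen_involution[OF assms] carrier_matD[OF Delta_gen_carrier[of n g]]
  unfolding invertible_mat_def inverts_mat_def square_mat.simps by metis

lemma forbidden_relation_fails:
  assumes "1 \<le> i" "i + 2 \<le> n"
  shows "Delta_word n [Rho i, Sig (i+1), Sig i] \<noteq> Delta_word n [Sig (i+1), Sig i, Rho (i+1)]"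
proof
  have valid: "i \<le> n - 1" "Suc i \<le> n - 1"
    using assms by linarith+
  assume "Delta_word n [Rho i, Sig (i+1), Sig i] = Delta_word n [Sig (i+1), Sig i, Rho (i+1)]"
  \<comment> \<open>The functional dual to \<open>f_i\<close>, evaluated at \<open>f_i\<close>: the
    left word moves \<open>f_i\<close> to \<open>f_(i+1)\<close>, giving 0; the right word fixes it,
    giving 1.\<close>
  from act_eq_if_Delta_word_eq[OF this, of "fI n i" "\<lambda>b. if b = F i then 1 else 0"]
  show False
    using assms valid by (auto simp: valid_word_def gen_idx_def index_less basis_of_fI)
qed

lemma rho_sigma_power_nontrivial:
  assumes "1 \<le> i" "i + 2 \<le> n"
  shows "Delta_word n (concat (replicate 6 [Rho i, Sig (i+1)])) \<noteq> 1\<^sub>m (3 * n)"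
proof
  have valid: "i \<le> n - 1" "Suc i \<le> n - 1"
    using assms by linarith+
  assume "Delta_word n (concat (replicate 6 [Rho i, Sig (i+1)])) = 1\<^sub>m (3 * n)"
  then have "Delta_word n (concat (replicate 6 [Rho i, Sig (i+1)])) = Delta_word n []"
    by (simp add: Delta_word_Nil)
  \<comment> \<open>The sixth power sends \<open>e_i\<close> to
    \<open>e_i - 2 g_(i+1) + 2 g_(i+2)\<close>, so the functional dual to \<open>g_(i+2)\<close>
    takes the value 2 there, but 0 at \<open>e_i\<close>.\<close>
  from act_eq_if_Delta_word_eq[OF this, of "eI n i" "\<lambda>b. if b = G (i + 2) then 1 else 0"]
  show False
    using assms valid index_less(1)[of i n]
    by (auto simp: valid_word_def gen_idx_def basis_of_eI numeral_eq_Suc)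
qed

theorem theorem3:
  fixes n :: nat
  shows "(\<forall>g. valid_word n [g] \<longrightarrow> invertible_mat (Delta_gen n g))
       \<and> (\<forall>u v. fvb_eq n u v \<longrightarrow> Delta_word n u = Delta_word n v)
       \<and> (\<forall>i. 1 \<le> i \<and> i \<le> n - 2 \<and> 3 \<le> n \<longrightarrow>
            Delta_word n [Rho i, Sig (i+1), Sig i] \<noteq> Delta_word n [Sig (i+1), Sig i, Rho (i+1)])
       \<and> (\<forall>i. 1 \<le> i \<and> i \<le> n - 2 \<longrightarrow>
            Delta_word n (concat (replicate 6 [Rho i, Sig (i+1)])) \<noteq> 1\<^sub>m (3 * n))"
  \<comment> \<open>Subtraction is truncated, but \<open>1 \<le> i\<close> and
    \<open>i \<le> n - 2\<close> together give \<open>i + 2 \<le> n\<close>.\<close>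
  using Delta_gen_invertible Delta_word_fvb_eq forbidden_relation_fails rho_sigma_power_nontrivial
  by (intro conjI allI impI) auto

end
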